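(* Let $(Y_i,Z_i)_{0\le i\le n}$ be the solution of the scheme $\mathcal E[(F_i),\xi]$ (see context). Assume: (a) $\xi\in L^\infty(\mathcal F_T)$; (b) each $F_i:\Omega\times\mathbb R\times\mathbb R^{1\times d}\to\mathbb R$, $0\le i\le n-1$, is $\mathcal F_{t_i}\otimes\mathcal B(\mathbb R)\otimes\mathcal B(\mathbb R^{1\times d})$-measurable, with $F_i(0,0)\in L^2(\mathcal F_{t_i})$ and $|F_i(y,z)-F_i(y',z')|\le K_y|y-y'|+K^n_z|z-z'|$, where the positive constants $K_y,K_z^n$ do not depend on $i$ ($K_y$ does not depend on $n$, $K^n_z$ may depend on $n$); $hK_y<1-\varepsilon$ for a given $\varepsilon\in(0,1)$ not depending on $n$; and $(\sup_{0\le i\le n-1}h_i|H_i|)K^n_z<1$; (c) $F_i(0,0)\in L^\infty(\mathcal F_{t_i})$ for $0\le i\le n-1$ and $\sup_{0\le i\le n-1}|F_i(0,0)|\le\tilde C$ for a constant $\tilde C$ not depending on $n$. Then, with a constant $C$ not depending on $n$, for all $0\le i\le n$, $$|Y_i|\le\Big(|\xi|_\infty+T\sup_{0\le j\le n-1}|F_j(0,0)|_\infty\Big)e^{CK_y/\varepsilon}\le\big(|\xi|_\infty+T\tilde C\big)e^{CK_y/\varepsilon}.$$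
   Context: $(\mathcal F_t)_{0\le t\le T}$ is the Brownian filtration on $(\Omega,\mathcal A,\mathbb P)$ of a $d$-dimensional Brownian motion, $\mathbb E_t[\cdot]=\mathbb E[\cdot|\mathcal F_t]$, and $|\cdot|_\infty$ is the $L^\infty$ norm. The grid is $0=t_0<\dots<t_n=T$, $h_i=t_{i+1}-t_i$, $h=\max_ih_i$, with $hn\le c_1$ and $h_in^\theta\ge c_2$ for constants $c_1,c_2>0$, $\theta\ge1$ independent of $n$. The coefficients $(H_i)_{0\le i<n}$ are independent $\mathbb R^{1\times d}$-valued random vectors such that $H_i$ is $\mathcal F_{t_{i+1}}$-measurable, $\mathbb E_{t_i}[H_i]=0$, and $c_iI_{d\times d}=h_i\mathbb E[H_i^\top H_i]=h_i\mathbb E_{t_i}[H_i^\top H_i]$ with $\lambda/d\le c_i\le\Lambda/d$ for positive constants $\lambda,\Lambda$ independent of $n$. The scheme $\mathcal E[(F_i),\xi]$ has solution $(Y_i,Z_i)_{0\le i\le n}$ (adapted to $(\mathcal F_{t_i})$) defined by $Y_n=\xi$, $Z_n=0$ and for $0\le i<n$ $$Y_i=\mathbb E_{t_i}[Y_{i+1}+h_iF_i(Y_i,Z_i)],\qquad Z_i=\mathbb E_{t_i}[Y_{i+1}H_i].$$ *)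

theory Defs
  imports "HOL-Probability.Probability"
begin

text \<open>Elements of \<open>\<real>\<^sup>d\<close> and of \<open>\<real>\<^bsup>1\<times>d\<^esup>\<close> are both modelled by \<^typ>\<open>real ^ 'd\<close>, with its Euclidean
  norm; \<open>d\<close> is \<open>CARD('d)\<close>.\<close>

text \<open>The increment over \<open>[s, t]\<close> has law \<open>N(0, (t - s) I)\<close>, whose density is the product of the
  one-dimensional ones (the last argument but one of \<^const>\<open>normal_density\<close> is the standard
  deviation).\<close>

definition brownian_motion :: "'w measure \<Rightarrow> real \<Rightarrow> (real \<Rightarrow> 'w \<Rightarrow> real ^ 'd) \<Rightarrow> bool" where
  "brownian_motion M T W \<longleftrightarrow>
     (\<forall>t\<in>{0..T}. W t \<in> borel_measurable M) \<and>
     (AE \<omega> in M. W 0 \<omega> = 0) \<and>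
     (AE \<omega> in M. continuous_on {0..T} (\<lambda>t. W t \<omega>)) \<and>
     (\<forall>s t. 0 \<le> s \<and> s < t \<and> t \<le> T \<longrightarrow>
        distributed M lborel (\<lambda>\<omega>. W t \<omega> - W s \<omega>)
          (\<lambda>x. ennreal (\<Prod>k\<in>UNIV. normal_density 0 (sqrt (t - s)) (x $ k)))) \<and>
     (\<forall>m (s :: nat \<Rightarrow> real). 0 \<le> s 0 \<and> (\<forall>j<m. s j \<le> s (Suc j)) \<and> s m \<le> T \<longrightarrow>
        prob_space.indep_vars M (\<lambda>_. borel) (\<lambda>j \<omega>. W (s (Suc j)) \<omega> - W (s j) \<omega>) {..<m})"

text \<open>The natural filtration of \<open>W\<close>, augmented by the null sets. \<^term>\<open>null_sets M\<close> consists of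
  measurable sets, so this is always a sub-\<open>\<sigma>\<close>-algebra of \<open>M\<close>, and it is the usual
  augmentation when \<open>M\<close> is complete.\<close>

definition brownian_filtration ::
  "'w measure \<Rightarrow> (real \<Rightarrow> 'w \<Rightarrow> real ^ 'd) \<Rightarrow> real \<Rightarrow> 'w measure" where
  "brownian_filtration M W t =
     sigma (space M)
       ({W s -` A \<inter> space M | s A. 0 \<le> s \<and> s \<le> t \<and> A \<in> sets borel} \<union> null_sets M)"

text \<open>Conditional expectation of vectors and matrices, taken coordinatewise. Like
  \<^const>\<open>real_cond_exp\<close>, it is only meaningful for integrable arguments.\<close>

definition vec_cond_exp ::
  "'w measure \<Rightarrow> 'w measure \<Rightarrow> ('w \<Rightarrow> 'v :: euclidean_space) \<Rightarrow> 'w \<Rightarrow> 'v" where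
  "vec_cond_exp M G X \<omega> = (\<Sum>b\<in>Basis. real_cond_exp M G (\<lambda>\<omega>'. X \<omega>' \<bullet> b) \<omega> *\<^sub>R b)"

definition in_L2 :: "'w measure \<Rightarrow> 'w measure \<Rightarrow> ('w \<Rightarrow> 'v :: euclidean_space) \<Rightarrow> bool" where
  "in_L2 M G X \<longleftrightarrow> X \<in> borel_measurable G \<and> integrable M (\<lambda>\<omega>. (norm (X \<omega>))\<^sup>2)"

definition in_Linf :: "'w measure \<Rightarrow> 'w measure \<Rightarrow> ('w \<Rightarrow> real) \<Rightarrow> bool" where
  "in_Linf M G X \<longleftrightarrow> X \<in> borel_measurable G \<and> esssup M (\<lambda>\<omega>. ereal \<bar>X \<omega>\<bar>) < \<infinity>"

definition Linf_norm :: "'w measure \<Rightarrow> ('w \<Rightarrow> real) \<Rightarrow> real" where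
  "Linf_norm M X = real_of_ereal (esssup M (\<lambda>\<omega>. ereal \<bar>X \<omega>\<bar>))"

definition step :: "(nat \<Rightarrow> real) \<Rightarrow> nat \<Rightarrow> real" where
  "step t i = t (Suc i) - t i"

definition max_step :: "(nat \<Rightarrow> real) \<Rightarrow> nat \<Rightarrow> real" where
  "max_step t n = (MAX i\<in>{..<n}. step t i)"

definition time_grid ::
  "real \<Rightarrow> real \<Rightarrow> real \<Rightarrow> real \<Rightarrow> nat \<Rightarrow> (nat \<Rightarrow> real) \<Rightarrow> bool" where
  "time_grid T c\<^sub>1 c\<^sub>2 \<theta> n t \<longleftrightarrow>
     1 \<le> n \<and> t 0 = 0 \<and> t n = T \<and> (\<forall>i<n. t i < t (Suc i)) \<and>
     max_step t n * real n \<le> c\<^sub>1 \<and> (\<forall>i<n. step t i * real n powr \<theta> \<ge> c\<^sub>2)"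

text \<open>The \<open>d \<times> d\<close> matrix \<open>v\<^sup>\<top> v\<close> of a row vector \<open>v\<close>.\<close>

definition outer_square :: "real ^ 'd \<Rightarrow> real ^ 'd ^ 'd" where
  "outer_square v = (columnvector v :: real ^ 1 ^ 'd) ** (rowvector v :: real ^ 'd ^ 1)"

text \<open>From here on, \<open>Fl\<close> is the filtration in continuous time, evaluated at the grid points.\<close>

definition scheme_coefficients ::
  "'w measure \<Rightarrow> (real \<Rightarrow> 'w measure) \<Rightarrow> real \<Rightarrow> real \<Rightarrow> nat \<Rightarrow> (nat \<Rightarrow> real) \<Rightarrow>
   (nat \<Rightarrow> 'w \<Rightarrow> real ^ 'd) \<Rightarrow> bool" where
  "scheme_coefficients M Fl lam Lam n t H \<longleftrightarrow>
     prob_space.indep_vars M (\<lambda>_. borel) H {..<n} \<and>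
     (\<forall>i<n. in_L2 M (Fl (t (Suc i))) (H i)) \<and>
     (\<forall>i<n. AE \<omega> in M. vec_cond_exp M (Fl (t i)) (H i) \<omega> = 0) \<and>
     (\<exists>c :: nat \<Rightarrow> real. \<forall>i<n.
        lam / real CARD('d) \<le> c i \<and> c i \<le> Lam / real CARD('d) \<and>
        c i *\<^sub>R mat 1 = step t i *\<^sub>R (\<integral>\<omega>. outer_square (H i \<omega>) \<partial>M) \<and>
        (AE \<omega> in M. c i *\<^sub>R mat 1 =
           step t i *\<^sub>R vec_cond_exp M (Fl (t i)) (\<lambda>\<omega>'. outer_square (H i \<omega>')) \<omega>))"

definition driver_measurable ::
  "(real \<Rightarrow> 'w measure) \<Rightarrow> nat \<Rightarrow> (nat \<Rightarrow> real) \<Rightarrow>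
   (nat \<Rightarrow> 'w \<Rightarrow> real \<Rightarrow> real ^ 'd \<Rightarrow> real) \<Rightarrow> bool" where
  "driver_measurable Fl n t F \<longleftrightarrow>
     (\<forall>i<n. (\<lambda>(\<omega>, y, z). F i \<omega> y z) \<in> borel_measurable (Fl (t i) \<Otimes>\<^sub>M (borel \<Otimes>\<^sub>M borel)))"

definition driver_lipschitz ::
  "'w measure \<Rightarrow> real \<Rightarrow> real \<Rightarrow> nat \<Rightarrow> (nat \<Rightarrow> 'w \<Rightarrow> real \<Rightarrow> real ^ 'd \<Rightarrow> real) \<Rightarrow> bool" where
  "driver_lipschitz M Ky Kz n F \<longleftrightarrow>
     (\<forall>i<n. AE \<omega> in M. \<forall>y y' z z'.
        \<bar>F i \<omega> y z - F i \<omega> y' z'\<bar> \<le> Ky * \<bar>y - y'\<bar> + Kz * norm (z - z'))"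

text \<open>Solutions of \<open>\<E>[(F\<^sub>i), \<xi>]\<close>. The only integrability demanded is what is needed for the
  two conditional expectations to make sense.\<close>

definition scheme_solution ::
  "'w measure \<Rightarrow> (real \<Rightarrow> 'w measure) \<Rightarrow> nat \<Rightarrow> (nat \<Rightarrow> real) \<Rightarrow> (nat \<Rightarrow> 'w \<Rightarrow> real ^ 'd) \<Rightarrow>
   (nat \<Rightarrow> 'w \<Rightarrow> real \<Rightarrow> real ^ 'd \<Rightarrow> real) \<Rightarrow> ('w \<Rightarrow> real) \<Rightarrow>
   (nat \<Rightarrow> 'w \<Rightarrow> real) \<Rightarrow> (nat \<Rightarrow> 'w \<Rightarrow> real ^ 'd) \<Rightarrow> bool" where
  "scheme_solution M Fl n t H F \<xi> Y Z \<longleftrightarrow>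
     (\<forall>i\<le>n. Y i \<in> borel_measurable (Fl (t i)) \<and> Z i \<in> borel_measurable (Fl (t i))) \<and>
     (AE \<omega> in M. Y n \<omega> = \<xi> \<omega>) \<and> (AE \<omega> in M. Z n \<omega> = 0) \<and>
     (\<forall>i<n.
        integrable M (\<lambda>\<omega>. Y (Suc i) \<omega> + step t i * F i \<omega> (Y i \<omega>) (Z i \<omega>)) \<and>
        (AE \<omega> in M. Y i \<omega> = real_cond_exp M (Fl (t i))
           (\<lambda>\<omega>'. Y (Suc i) \<omega>' + step t i * F i \<omega>' (Y i \<omega>') (Z i \<omega>')) \<omega>) \<and>
        integrable M (\<lambda>\<omega>. Y (Suc i) \<omega> *\<^sub>R H i \<omega>) \<and>
        (AE \<omega> in M. Z i \<omega> = vec_cond_exp M (Fl (t i)) (\<lambda>\<omega>'. Y (Suc i) \<omega>' *\<^sub>R H i \<omega>') \<omega>))"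

end

theory Submission
  imports Defs
begin

text \<open>
  Lipschitz continuity of the driver gives
  \<open>(1 - h\<^sub>i K\<^sub>y) |Y\<^sub>i| \<le> |E\<^sub>i Y\<^sub>i\<^sub>+\<^sub>1| + h\<^sub>i K\<^sub>z |E\<^sub>i[Y\<^sub>i\<^sub>+\<^sub>1 H\<^sub>i]| + h\<^sub>i |F\<^sub>i(0,0)|\<close>. For a unit vector \<open>u\<close> and a sign \<open>s\<close>,
  the weight \<open>1 + s h\<^sub>i K\<^sub>z H\<^sub>i\<cdot>u\<close> is nonnegative, because \<open>h\<^sub>i |H\<^sub>i| K\<^sub>z < 1\<close>, and has conditional
  expectation one. Hence the first two terms are together at most the bound of \<open>|Y\<^sub>i\<^sub>+\<^sub>1|\<close>, with
  constant one, and backward induction loses only the factors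
  \<open>1 / (1 - h\<^sub>i K\<^sub>y) \<le> exp (h\<^sub>i K\<^sub>y / \<epsilon>)\<close>, whose product is at most \<open>exp (T K\<^sub>y / \<epsilon>)\<close>; so \<open>C = T\<close>.
\<close>

section \<open>The augmented Brownian filtration\<close>

lemma subalgebra_brownian_filtration:
  assumes "brownian_motion M T W" and "t \<le> T"
  shows "subalgebra M (brownian_filtration M W t)"
proof -
  let ?G = "{W s -` A \<inter> space M | s A. 0 \<le> s \<and> s \<le> t \<and> A \<in> sets borel} \<union> null_sets M"
  have G: "?G \<subseteq> sets M"
    using assms by (auto simp: brownian_motion_def intro!: measurable_sets)
  then have "?G \<subseteq> Pow (space M)"
    using sets.sets_into_space by blast
  then show ?thesis
    using sets.sigma_sets_subset[OF G]
    by (simp add: subalgebra_def brownian_filtration_def space_measure_of_conv sets_measure_of)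
qed

section \<open>Essential suprema as real numbers\<close>

context prob_space
begin

text \<open>On a space of measure zero the essential supremum would be -\<infinity>. A probability
  measure excludes this, because a statement about constants that holds almost everywhere is then
  simply true.\<close>

lemma esssup_abs_nonneg: "0 \<le> esssup M (\<lambda>\<omega>. ereal \<bar>X \<omega>\<bar>)"
proof -
  have "AE \<omega> in M. 0 \<le> esssup M (\<lambda>\<omega>. ereal \<bar>X \<omega>\<bar>)"
    using esssup_AE[of "\<lambda>\<omega>. ereal \<bar>X \<omega>\<bar>" M]
  proof eventually_elim
    case (elim \<omega>)
    then show ?case
      by (meson abs_ge_zero ereal_less_eq(5) order_trans)
  qed
  then show ?thesis
    by simp
qed

lemma Linf_norm_nonneg: "0 \<le> Linf_norm M X"
  using esssup_abs_nonneg by (simp add: Linf_norm_def real_of_ereal_pos)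

lemma AE_abs_le_Linf_norm:
  assumes "in_Linf M G X"
  shows "AE \<omega> in M. \<bar>X \<omega>\<bar> \<le> Linf_norm M X"
proof -
  \<comment> \<open>\<open>in_Linf\<close> excludes +\<infinity> and nonnegativity excludes
    -\<infinity>, so \<open>real_of_ereal\<close> does not fall back on its default value 0.\<close>
  have "ereal (Linf_norm M X) = esssup M (\<lambda>\<omega>. ereal \<bar>X \<omega>\<bar>)"
    using assms esssup_abs_nonneg[of X] by (auto simp: in_Linf_def Linf_norm_def ereal_real')
  from esssup_AE[of "\<lambda>\<omega>. ereal \<bar>X \<omega>\<bar>" M, folded this] show ?thesis
    by simp
qed

lemma Linf_norm_le:
  assumes "X \<in> borel_measurable M" and "AE \<omega> in M. \<bar>X \<omega>\<bar> \<le> c"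
  shows "Linf_norm M X \<le> c"
proof -
  have "esssup M (\<lambda>\<omega>. ereal \<bar>X \<omega>\<bar>) \<le> ereal c"
    using assms by (intro esssup_I) auto
  then show ?thesis
    using esssup_abs_nonneg[of X] unfolding Linf_norm_def
    by (cases "esssup M (\<lambda>\<omega>. ereal \<bar>X \<omega>\<bar>)") auto
qed

end

section \<open>Conditional expectation of vectors\<close>

lemma (in sigma_finite_subalgebra) vec_cond_exp_inner:
  fixes X :: "'a \<Rightarrow> 'v :: euclidean_space"
  assumes "integrable M X"
  shows "AE \<omega> in M. real_cond_exp M F (\<lambda>\<omega>'. X \<omega>' \<bullet> u) \<omega> = vec_cond_exp M F X \<omega> \<bullet> u"
proof -
  have int: "integrable M (\<lambda>\<omega>. X \<omega> \<bullet> b)" for b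
    using assms by simp
  have "AE \<omega> in M. real_cond_exp M F (\<lambda>\<omega>'. \<Sum>b\<in>Basis. (u \<bullet> b) * (X \<omega>' \<bullet> b)) \<omega> =
      (\<Sum>b\<in>Basis. real_cond_exp M F (\<lambda>\<omega>'. (u \<bullet> b) * (X \<omega>' \<bullet> b)) \<omega>)"
    using int by (intro real_cond_exp_sum) auto
  moreover have "AE \<omega> in M. \<forall>b\<in>Basis. real_cond_exp M F (\<lambda>\<omega>'. (u \<bullet> b) * (X \<omega>' \<bullet> b)) \<omega> =
      (u \<bullet> b) * real_cond_exp M F (\<lambda>\<omega>'. X \<omega>' \<bullet> b) \<omega>"
    using int by (intro AE_finite_allI real_cond_exp_cmult) auto
  ultimately show ?thesis
  proof eventually_elim
    case (elim \<omega>)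
    have "(\<lambda>\<omega>'. X \<omega>' \<bullet> u) = (\<lambda>\<omega>'. \<Sum>b\<in>Basis. (u \<bullet> b) * (X \<omega>' \<bullet> b))"
      by (subst euclidean_inner) (simp add: mult.commute)
    with elim show ?case
      by (simp add: vec_cond_exp_def inner_sum_left inner_commute[of u] mult.commute)
  qed
qed

text \<open>Bounding the two terms separately would only give \<open>2 * B\<close>, and the factor 2
  would accumulate over the time steps. Treating them jointly through one nonnegative weight keeps
  the constant one.\<close>

lemma (in finite_measure_subalgebra) abs_cond_exp_plus_norm_cond_exp_le:
  fixes Y :: "'a \<Rightarrow> real" and H :: "'a \<Rightarrow> 'v :: euclidean_space"
  assumes Y: "integrable M Y" and YB: "AE \<omega> in M. \<bar>Y \<omega>\<bar> \<le> B"
    and H: "integrable M H" and YH: "integrable M (\<lambda>\<omega>. Y \<omega> *\<^sub>R H \<omega>)"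
    and centred: "AE \<omega> in M. vec_cond_exp M F H \<omega> = 0"
    and k: "0 \<le> k" and kH: "AE \<omega> in M. k * norm (H \<omega>) \<le> 1"
  shows "AE \<omega> in M. \<bar>real_cond_exp M F Y \<omega>\<bar>
    + k * norm (vec_cond_exp M F (\<lambda>\<omega>'. Y \<omega>' *\<^sub>R H \<omega>') \<omega>) \<le> B"
proof -
  let ?a = "real_cond_exp M F Y" and ?z = "vec_cond_exp M F (\<lambda>\<omega>'. Y \<omega>' *\<^sub>R H \<omega>')"
  \<comment> \<open>The direction \<open>u\<close> is not normalised: with the factor
    \<open>norm u\<close> on both sides the inequality is meaningful on the whole space, so a dense
    subset of the space can be used instead of one of the unit sphere.\<close>
  have dir: "AE \<omega> in M. s * norm u * ?a \<omega> + k * (?z \<omega> \<bullet> u) \<le> B * norm u"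
    if s: "\<bar>s\<bar> = 1" for s :: real and u
  proof -
    have ss: "s * s = 1"
      using s by (metis abs_mult_self_eq mult_1)
    let ?l = "\<lambda>\<omega>. s * norm u * Y \<omega> + k * ((Y \<omega> *\<^sub>R H \<omega>) \<bullet> u)"
    let ?r = "\<lambda>\<omega>. B * norm u + (B * s * k) * (H \<omega> \<bullet> u)"
    have iYHu: "integrable M (\<lambda>\<omega>. (Y \<omega> *\<^sub>R H \<omega>) \<bullet> u)" and iHu: "integrable M (\<lambda>\<omega>. H \<omega> \<bullet> u)"
      using integrable_inner_left[OF YH] integrable_inner_left[OF H] by blast+
    have le: "AE \<omega> in M. ?l \<omega> \<le> ?r \<omega>"
      using YB kH
    proof eventually_elim
      case (elim \<omega>)
      have "\<bar>k * (H \<omega> \<bullet> u)\<bar> \<le> (k * norm (H \<omega>)) * norm u"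
        using Cauchy_Schwarz_ineq2[of "H \<omega>" u] k by (simp add: abs_mult mult.assoc mult_left_mono)
      also have "\<dots> \<le> norm u"
        using elim(2) by (simp add: mult_left_le_one_le k)
      finally have w: "0 \<le> norm u + s * (k * (H \<omega> \<bullet> u))"
        using s by (auto simp: abs_if split: if_splits)
      \<comment> \<open>As \<open>s * s = 1\<close>, the sign can be shared between \<open>Y\<close>
        and the weight; then \<open>s * Y \<omega> \<le> B\<close> is multiplied by the nonnegative
        weight.\<close>
      have "?l \<omega> = (s * Y \<omega>) * (norm u + s * (k * (H \<omega> \<bullet> u)))"
        using ss by (simp add: algebra_simps)
      also have "\<dots> \<le> B * (norm u + s * (k * (H \<omega> \<bullet> u)))"
        using elim(1) s by (intro mult_right_mono[OF _ w]) (auto simp: abs_if split: if_splits)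
      finally show ?case
        by (simp add: algebra_simps)
    qed
    have "AE \<omega> in M. real_cond_exp M F ?l \<omega> \<le> real_cond_exp M F ?r \<omega>"
      using Y iYHu iHu by (intro real_cond_exp_mono[OF le]) auto
    moreover have "AE \<omega> in M. real_cond_exp M F ?l \<omega> =
        real_cond_exp M F (\<lambda>\<omega>. s * norm u * Y \<omega>) \<omega> +
        real_cond_exp M F (\<lambda>\<omega>. k * ((Y \<omega> *\<^sub>R H \<omega>) \<bullet> u)) \<omega>"
      using Y iYHu by (intro real_cond_exp_add) auto
    moreover have "AE \<omega> in M. real_cond_exp M F (\<lambda>\<omega>. s * norm u * Y \<omega>) \<omega> = s * norm u * ?a \<omega>"
      using Y by (rule real_cond_exp_cmult)
    moreover have "AE \<omega> in M. real_cond_exp M F (\<lambda>\<omega>. k * ((Y \<omega> *\<^sub>R H \<omega>) \<bullet> u)) \<omega> =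
        k * real_cond_exp M F (\<lambda>\<omega>. (Y \<omega> *\<^sub>R H \<omega>) \<bullet> u) \<omega>"
      using iYHu by (rule real_cond_exp_cmult)
    moreover have "AE \<omega> in M. real_cond_exp M F ?r \<omega> =
        real_cond_exp M F (\<lambda>_. B * norm u) \<omega> +
        real_cond_exp M F (\<lambda>\<omega>. (B * s * k) * (H \<omega> \<bullet> u)) \<omega>"
      using iHu by (intro real_cond_exp_add) auto
    moreover have "AE \<omega> in M. real_cond_exp M F (\<lambda>_. B * norm u) \<omega> = B * norm u"
      by (intro real_cond_exp_F_meas) auto
    moreover have "AE \<omega> in M. real_cond_exp M F (\<lambda>\<omega>. (B * s * k) * (H \<omega> \<bullet> u)) \<omega> =
        (B * s * k) * real_cond_exp M F (\<lambda>\<omega>. H \<omega> \<bullet> u) \<omega>"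
      using iHu by (rule real_cond_exp_cmult)
    ultimately show ?thesis
      using vec_cond_exp_inner[OF YH, of u] vec_cond_exp_inner[OF H, of u] centred
      by eventually_elim simp
  qed
  text \<open>The optimal direction \<open>u = z(\<omega>)\<close> is random; a countable dense set of directions handles
    it through a single null set.\<close>
  obtain D :: "'v set" where D: "countable D" "\<And>X. open X \<Longrightarrow> X \<noteq> {} \<Longrightarrow> \<exists>d\<in>D. d \<in> X"
    by (rule countable_dense_setE) blast
  have dense: "closure D = UNIV"
    using D(2)[of "- closure D"] closure_subset[of D] by auto
  have "AE \<omega> in M. \<forall>s\<in>{-1, 1}. \<forall>u\<in>D. s * norm u * ?a \<omega> + k * (?z \<omega> \<bullet> u) \<le> B * norm u"
    by (intro AE_finite_allI AE_ball_countable[OF D(1), THEN iffD2] ballI dir) auto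
  then show ?thesis
  proof eventually_elim
    case (elim \<omega>)
    have all: "s * norm u * ?a \<omega> + k * (?z \<omega> \<bullet> u) \<le> B * norm u" if "s \<in> {-1, 1}" for s u
    proof -
      \<comment> \<open>With \<open>\<omega>\<close> fixed, both sides are continuous in
        \<open>u\<close>, so the inequality extends from \<open>D\<close> to its closure.\<close>
      let ?S = "{u. s * norm u * ?a \<omega> + k * (?z \<omega> \<bullet> u) \<le> B * norm u}"
      have "closed ?S"
        by (intro closed_Collect_le continuous_intros)
      moreover have "D \<subseteq> ?S"
        using elim that by auto
      ultimately show ?thesis
        using closure_minimal[of D ?S] dense by auto
    qed
    \<comment> \<open>The direction of \<open>?z \<omega>\<close> turns the inner product into the
      norm; if \<open>?z \<omega> = 0\<close>, any unit vector serves.\<close>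
    obtain u :: 'v where u: "norm u = 1" "?z \<omega> \<bullet> u = norm (?z \<omega>)"
    proof (cases "?z \<omega> = 0")
      case True
      then show thesis
        using that[of "SOME b. b \<in> Basis"] by (simp add: SOME_Basis)
    next
      case False
      then show thesis
        using that[of "sgn (?z \<omega>)"]
        by (simp add: norm_sgn sgn_div_norm power2_norm_eq_inner[symmetric] power2_eq_square)
    qed
    show ?case
      \<comment> \<open>One of the two signs turns \<open>s * ?a \<omega>\<close> into the absolute
        value.\<close>
      using all[of 1 u] all[of "-1" u] u by (simp add: abs_if)
  qed
qed

section \<open>One implicit step of the scheme\<close>

lemma one_le_exp_mult_one_minus:
  fixes x \<epsilon> :: real
  assumes "0 \<le> x" "x < 1 - \<epsilon>" "0 < \<epsilon>"
  shows "1 \<le> exp (x / \<epsilon>) * (1 - x)"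
proof -
  \<comment> \<open>After multiplication by \<open>\<epsilon>\<close>, this is exactly what
    \<open>1 \<le> (1 + x / \<epsilon>) * (1 - x)\<close> requires.\<close>
  have "x * x \<le> x * (1 - \<epsilon>)"
    using assms by (intro mult_left_mono) auto
  then have "1 \<le> (1 + x / \<epsilon>) * (1 - x)"
    using assms by (simp add: field_simps)
  also have "\<dots> \<le> exp (x / \<epsilon>) * (1 - x)"
    using assms by (intro mult_right_mono exp_ge_add_one_self) auto
  finally show ?thesis .
qed

lemma (in finite_measure_subalgebra) implicit_step_bound:
  fixes Y Y' :: "'a \<Rightarrow> real" and Z H :: "'a \<Rightarrow> 'v :: euclidean_space"
    and f :: "'a \<Rightarrow> real \<Rightarrow> 'v \<Rightarrow> real"
  assumes f: "(\<lambda>(\<omega>, y, z). f \<omega> y z) \<in> borel_measurable (F \<Otimes>\<^sub>M (borel \<Otimes>\<^sub>M borel))"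
    and lip: "AE \<omega> in M. \<forall>y y' z z'.
      \<bar>f \<omega> y z - f \<omega> y' z'\<bar> \<le> Ky * \<bar>y - y'\<bar> + Kz * norm (z - z')"
    and f0: "AE \<omega> in M. \<bar>f \<omega> 0 0\<bar> \<le> K"
    and meas: "Y \<in> borel_measurable F" "Z \<in> borel_measurable F"
    and Y': "Y' \<in> borel_measurable M" "AE \<omega> in M. \<bar>Y' \<omega>\<bar> \<le> B"
    and int: "integrable M (\<lambda>\<omega>. Y' \<omega> + h * f \<omega> (Y \<omega>) (Z \<omega>))"
    and Y: "AE \<omega> in M. Y \<omega> = real_cond_exp M F (\<lambda>\<omega>'. Y' \<omega>' + h * f \<omega>' (Y \<omega>') (Z \<omega>')) \<omega>"
    and Y'H: "integrable M (\<lambda>\<omega>. Y' \<omega> *\<^sub>R H \<omega>)"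
    and Z: "AE \<omega> in M. Z \<omega> = vec_cond_exp M F (\<lambda>\<omega>'. Y' \<omega>' *\<^sub>R H \<omega>') \<omega>"
    and H: "integrable M H" "AE \<omega> in M. vec_cond_exp M F H \<omega> = 0"
    and hH: "AE \<omega> in M. h * Kz * norm (H \<omega>) \<le> 1"
    and "0 \<le> h" "0 \<le> Kz"
  shows "AE \<omega> in M. (1 - h * Ky) * \<bar>Y \<omega>\<bar> \<le> B + h * K"
proof -
  \<comment> \<open>Only the sum of \<open>Y'\<close> and the driver term is assumed integrable.
    Boundedness makes \<open>Y'\<close> integrable on its own, hence the driver term too, and the
    conditional expectation can be split.\<close>
  have iY': "integrable M Y'"
    using Y' by (intro integrable_const_bound[of _ B]) auto
  let ?g = "\<lambda>\<omega>. h * f \<omega> (Y \<omega>) (Z \<omega>)"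
  have ig: "integrable M ?g"
    using Bochner_Integration.integrable_diff[OF int iY'] by simp
  \<comment> \<open>Joint measurability of the driver makes its value along \<open>Y\<close> and
    \<open>Z\<close> measurable for \<open>F\<close>, so conditioning leaves it unchanged.\<close>
  have "(\<lambda>\<omega>. (\<omega>, Y \<omega>, Z \<omega>)) \<in> F \<rightarrow>\<^sub>M F \<Otimes>\<^sub>M (borel \<Otimes>\<^sub>M borel)"
    using meas by measurable
  from measurable_compose[OF this f] have mg: "?g \<in> borel_measurable F"
    by simp
  have "AE \<omega> in M. real_cond_exp M F (\<lambda>\<omega>'. Y' \<omega>' + ?g \<omega>') \<omega> =
      real_cond_exp M F Y' \<omega> + real_cond_exp M F ?g \<omega>"
    using iY' ig by (rule real_cond_exp_add)
  moreover have "AE \<omega> in M. real_cond_exp M F ?g \<omega> = ?g \<omega>"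
    using ig mg by (rule real_cond_exp_F_meas)
  moreover have "AE \<omega> in M. \<bar>real_cond_exp M F Y' \<omega>\<bar>
      + h * Kz * norm (vec_cond_exp M F (\<lambda>\<omega>'. Y' \<omega>' *\<^sub>R H \<omega>') \<omega>) \<le> B"
    using iY' Y'(2) H(1) Y'H H(2) _ hH
    by (rule abs_cond_exp_plus_norm_cond_exp_le) (simp add: \<open>0 \<le> h\<close> \<open>0 \<le> Kz\<close>)
  ultimately show ?thesis
    using lip f0 Y Z
  proof eventually_elim
    case (elim \<omega>)
    have "\<bar>f \<omega> (Y \<omega>) (Z \<omega>)\<bar> \<le> K + Ky * \<bar>Y \<omega>\<bar> + Kz * norm (Z \<omega>)"
      using elim(4)[rule_format, of "Y \<omega>" "Z \<omega>" 0 0] elim(5) by simp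
    from mult_left_mono[OF this \<open>0 \<le> h\<close>]
    have "\<bar>?g \<omega>\<bar> \<le> h * K + h * Ky * \<bar>Y \<omega>\<bar> + h * Kz * norm (Z \<omega>)"
      using \<open>0 \<le> h\<close> by (simp add: abs_mult algebra_simps)
    moreover have "\<bar>Y \<omega>\<bar> \<le> \<bar>real_cond_exp M F Y' \<omega>\<bar> + \<bar>?g \<omega>\<bar>"
      using elim(1,2,6) by linarith
    \<comment> \<open>The term in \<open>norm (Z \<omega>)\<close> and the conditional expectation
      of \<open>Y'\<close> are together at most \<open>B\<close>; the term in
      \<open>\<bar>Y \<omega>\<bar>\<close> is absorbed on the left.\<close>
    ultimately show ?case
      using elim(3,7) by (simp add: algebra_simps)
  qed
qed

section \<open>Backward induction along the grid\<close>

lemma (in finite_measure) integrable_of_in_L2: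
  assumes "in_L2 M G X" and "subalgebra M G"
  shows "integrable M X"
proof (rule Bochner_Integration.integrable_bound)
  show "integrable M (\<lambda>\<omega>. 1 + (norm (X \<omega>))\<^sup>2)"
    using assms by (simp add: in_L2_def)
  show "X \<in> borel_measurable M"
    using assms by (auto simp: in_L2_def intro: measurable_from_subalg)
  show "AE \<omega> in M. norm (X \<omega>) \<le> norm (1 + (norm (X \<omega>))\<^sup>2)"
  proof (rule AE_I2)
    fix \<omega>
    show "norm (X \<omega>) \<le> norm (1 + (norm (X \<omega>))\<^sup>2)"
      \<comment> \<open>Expanding \<open>(x - 1)^2 \<ge> 0\<close> gives
        \<open>2 * x \<le> 1 + x^2\<close> for the norm \<open>x\<close>.\<close>
      using zero_le_power2[of "norm (X \<omega>) - 1"] zero_le_power2[of "norm (X \<omega>)"]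
        abs_ge_self[of "1 + (norm (X \<omega>))\<^sup>2"]
      unfolding real_norm_def power2_diff one_power2 mult_1_right by linarith
  qed
qed

lemma time_grid_mono:
  assumes "time_grid T c\<^sub>1 c\<^sub>2 \<theta> n t" and "i \<le> j" "j \<le> n"
  shows "t i \<le> t j"
  using assms(2,3)
proof (induction j rule: dec_induct)
  case (step j)
  then have "t j < t (Suc j)"
    using assms(1) by (simp add: time_grid_def)
  with step show ?case
    by simp
qed simp

lemma time_grid_bounds:
  assumes "time_grid T c\<^sub>1 c\<^sub>2 \<theta> n t" and "i \<le> n"
  shows "0 \<le> t i" "t i \<le> T"
  using time_grid_mono[OF assms(1), of 0 i] time_grid_mono[OF assms(1), of i n] assms
  by (auto simp: time_grid_def)

text \<open>The remaining time \<open>T - t i\<close> replaces \<open>T\<close> so that the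
  induction closes: a step back by \<open>h\<close> adds \<open>h * K\<close> to the first factor
  and \<open>h * Ky / \<epsilon>\<close> to the exponent. The induction hypothesis also supplies the
  boundedness of \<open>Y (Suc i)\<close> that the one-step estimate needs.\<close>

lemma (in prob_space) scheme_solution_bound:
  fixes W :: "real \<Rightarrow> 'a \<Rightarrow> real ^ 'd"
  defines "Fl \<equiv> brownian_filtration M W"
  assumes W: "brownian_motion M T W"
    and Ky: "0 < Ky" and \<epsilon>: "0 < \<epsilon>" and Kz: "0 < Kz"
    and grid: "time_grid T c\<^sub>1 c\<^sub>2 \<theta> n t"
    and coeff: "scheme_coefficients M Fl lam Lam n t H"
    and sol: "scheme_solution M Fl n t H F \<xi> Y Z"
    and \<xi>: "AE \<omega> in M. \<bar>\<xi> \<omega>\<bar> \<le> N"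
    and meas: "driver_measurable Fl n t F"
    and lip: "driver_lipschitz M Ky Kz n F"
    and hKy: "max_step t n * Ky < 1 - \<epsilon>"
    and hH: "AE \<omega> in M. (SUP i\<in>{..<n}. step t i * norm (H i \<omega>)) * Kz < 1"
    and F0: "\<forall>i<n. AE \<omega> in M. \<bar>F i \<omega> 0 0\<bar> \<le> K"
    and K: "0 \<le> K" and "i \<le> n"
  shows "AE \<omega> in M. \<bar>Y i \<omega>\<bar> \<le> (N + (T - t i) * K) * exp ((T - t i) * Ky / \<epsilon>)"
  using \<open>i \<le> n\<close>
proof (induction i rule: inc_induct)
  case base
  have "AE \<omega> in M. Y n \<omega> = \<xi> \<omega>" and "t n = T"
    using sol grid by (auto simp: scheme_solution_def time_grid_def)
  then show ?case
    using \<xi> by (auto elim: AE_mp)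
next
  case (step i)
  let ?h = "Defs.step t i"
  let ?B = "(N + (T - t (Suc i)) * K) * exp ((T - t (Suc i)) * Ky / \<epsilon>)"
  have i: "i < n" by fact
  have sub: "subalgebra M (Fl (t j))" if "j \<le> n" for j
    using subalgebra_brownian_filtration[OF W] time_grid_bounds[OF grid] that
    by (simp add: Fl_def)
  interpret G: finite_measure_subalgebra M "Fl (t i)"
    using sub i by unfold_locales simp
  have h: "0 \<le> ?h"
    using grid i by (simp add: time_grid_def Defs.step_def less_imp_le)
  have "?h \<le> max_step t n"
    using i by (simp add: max_step_def)
  then have hKy': "?h * Ky < 1 - \<epsilon>"
    using hKy mult_right_mono[of ?h "max_step t n" Ky] Ky by linarith
  have sol_i: "Y i \<in> borel_measurable (Fl (t i))" "Z i \<in> borel_measurable (Fl (t i))"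
      "Y (Suc i) \<in> borel_measurable (Fl (t (Suc i)))"
      "integrable M (\<lambda>\<omega>. Y (Suc i) \<omega> + ?h * F i \<omega> (Y i \<omega>) (Z i \<omega>))"
      "AE \<omega> in M. Y i \<omega> = real_cond_exp M (Fl (t i))
         (\<lambda>\<omega>'. Y (Suc i) \<omega>' + ?h * F i \<omega>' (Y i \<omega>') (Z i \<omega>')) \<omega>"
      "integrable M (\<lambda>\<omega>. Y (Suc i) \<omega> *\<^sub>R H i \<omega>)"
      "AE \<omega> in M. Z i \<omega> = vec_cond_exp M (Fl (t i)) (\<lambda>\<omega>'. Y (Suc i) \<omega>' *\<^sub>R H i \<omega>') \<omega>"
    using sol i by (simp_all add: scheme_solution_def Suc_leI)
  have Y': "Y (Suc i) \<in> borel_measurable M"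
    using measurable_from_subalg[OF sub sol_i(3)] i by simp
  have H: "integrable M (H i)" "AE \<omega> in M. vec_cond_exp M (Fl (t i)) (H i) \<omega> = 0"
    using integrable_of_in_L2[OF _ sub[of "Suc i"]] coeff i
    by (auto simp: scheme_coefficients_def)
  have hH_i: "AE \<omega> in M. ?h * Kz * norm (H i \<omega>) \<le> 1"
    using hH
  proof eventually_elim
    case (elim \<omega>)
    \<comment> \<open>The index set is finite, so the supremum is a genuine upper bound at every
      \<open>\<omega>\<close>.\<close>
    have "?h * norm (H i \<omega>) \<le> (SUP i\<in>{..<n}. Defs.step t i * norm (H i \<omega>))"
      using i by (intro cSUP_upper) auto
    from mult_right_mono[OF this less_imp_le[OF Kz]] elim
    have "?h * norm (H i \<omega>) * Kz < 1"
      by (rule le_less_trans)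
    then show ?case
      by (simp add: mult.assoc mult.commute[of Kz])
  qed
  have F_i: "(\<lambda>(\<omega>, y, z). F i \<omega> y z) \<in> borel_measurable (Fl (t i) \<Otimes>\<^sub>M (borel \<Otimes>\<^sub>M borel))"
      "AE \<omega> in M. \<forall>y y' z z'.
         \<bar>F i \<omega> y z - F i \<omega> y' z'\<bar> \<le> Ky * \<bar>y - y'\<bar> + Kz * norm (z - z')"
    using meas lip i by (auto simp: driver_measurable_def driver_lipschitz_def)
  have "AE \<omega> in M. (1 - ?h * Ky) * \<bar>Y i \<omega>\<bar> \<le> ?B + ?h * K"
    using F_i F0[rule_format, OF i] sol_i(1,2) Y' step.IH sol_i(4-7) H hH_i h less_imp_le[OF Kz]
    by (rule G.implicit_step_bound)
  then show ?case
  proof eventually_elim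
    case (elim \<omega>)
    let ?e = "exp (?h * Ky / \<epsilon>)" and ?r = "exp ((T - t (Suc i)) * Ky / \<epsilon>)"
    have r: "1 \<le> ?r"
      using time_grid_bounds[OF grid, of "Suc i"] i Ky \<epsilon> by simp
    have "\<bar>Y i \<omega>\<bar> \<le> ?e * (1 - ?h * Ky) * \<bar>Y i \<omega>\<bar>"
      using mult_right_mono[OF one_le_exp_mult_one_minus, of "?h * Ky" \<epsilon> "\<bar>Y i \<omega>\<bar>"]
        h Ky \<epsilon> hKy' by simp
    also have "\<dots> \<le> ?e * (?B + ?h * K)"
      using elim by (simp add: mult.assoc)
    \<comment> \<open>Since \<open>1 \<le> ?r\<close>, the new driver contribution can be put under
      the exponential already present in \<open>?B\<close>.\<close>
    also have "\<dots> \<le> ?e * (?B + ?h * K * ?r)"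
      using r h K mult_left_mono[OF r, of "?h * K"] by simp
    also have "\<dots> = (N + (T - t (Suc i) + ?h) * K) * (?r * ?e)"
      by (simp add: algebra_simps)
    also have "T - t (Suc i) + ?h = T - t i"
      by (simp add: Defs.step_def)
    also have "?r * ?e = exp ((T - t i) * Ky / \<epsilon>)"
      unfolding exp_add[symmetric] add_divide_distrib[symmetric] distrib_right[symmetric]
      by (simp add: Defs.step_def)
    finally show ?case .
  qed
qed

section \<open>The bound with constants independent of the grid\<close>

theorem proposition2p6:
  fixes M :: "'w measure"
    and W :: "real \<Rightarrow> 'w \<Rightarrow> real ^ 'd"
    and T c\<^sub>1 c\<^sub>2 \<theta> lam Lam :: real
  defines "Fl \<equiv> brownian_filtration M W"
  assumes "prob_space M"
    and "0 < T"
    and "brownian_motion M T W"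
    and "0 < c\<^sub>1" "0 < c\<^sub>2" "1 \<le> \<theta>"
    and "0 < lam" "0 < Lam"
  shows "\<exists>C>0. \<forall>(Ky :: real) (\<epsilon> :: real) (Ct :: real).
    0 < Ky \<and> 0 < \<epsilon> \<and> \<epsilon> < 1 \<longrightarrow>
    (\<forall>(n :: nat) (t :: nat \<Rightarrow> real) (H :: nat \<Rightarrow> 'w \<Rightarrow> real ^ 'd) (Kz :: real)
       (F :: nat \<Rightarrow> 'w \<Rightarrow> real \<Rightarrow> real ^ 'd \<Rightarrow> real) (\<xi> :: 'w \<Rightarrow> real)
       (Y :: nat \<Rightarrow> 'w \<Rightarrow> real) (Z :: nat \<Rightarrow> 'w \<Rightarrow> real ^ 'd).
       time_grid T c\<^sub>1 c\<^sub>2 \<theta> n t \<and>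
       scheme_coefficients M Fl lam Lam n t H \<and>
       scheme_solution M Fl n t H F \<xi> Y Z \<and>
       in_Linf M (Fl T) \<xi> \<and>
       driver_measurable Fl n t F \<and>
       (\<forall>i<n. in_L2 M (Fl (t i)) (\<lambda>\<omega>. F i \<omega> 0 0)) \<and>
       0 < Kz \<and>
       driver_lipschitz M Ky Kz n F \<and>
       max_step t n * Ky < 1 - \<epsilon> \<and>
       (AE \<omega> in M. (SUP i\<in>{..<n}. step t i * norm (H i \<omega>)) * Kz < 1) \<and>
       (\<forall>i<n. in_Linf M (Fl (t i)) (\<lambda>\<omega>. F i \<omega> 0 0)) \<and>
       (AE \<omega> in M. (SUP i\<in>{..<n}. \<bar>F i \<omega> 0 0\<bar>) \<le> Ct) \<longrightarrow>
       (\<forall>i\<le>n. AE \<omega> in M.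
          \<bar>Y i \<omega>\<bar> \<le> (Linf_norm M \<xi> + T * (SUP j\<in>{..<n}. Linf_norm M (\<lambda>\<omega>. F j \<omega> 0 0)))
                       * exp (C * Ky / \<epsilon>)) \<and>
       (Linf_norm M \<xi> + T * (SUP j\<in>{..<n}. Linf_norm M (\<lambda>\<omega>. F j \<omega> 0 0))) * exp (C * Ky / \<epsilon>)
         \<le> (Linf_norm M \<xi> + T * Ct) * exp (C * Ky / \<epsilon>))"
proof (intro exI[of _ T] conjI[OF \<open>0 < T\<close>] allI impI, goal_cases)
  case (1 Ky \<epsilon> Ct n t H Kz F \<xi> Y Z)
  interpret prob_space M by fact
  let ?N = "Linf_norm M \<xi>" and ?K = "SUP j\<in>{..<n}. Linf_norm M (\<lambda>\<omega>. F j \<omega> 0 0)"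
  have pos: "0 < Ky" "0 < \<epsilon>" "0 < Kz" and grid: "time_grid T c\<^sub>1 c\<^sub>2 \<theta> n t"
    and F0: "\<forall>i<n. in_Linf M (Fl (t i)) (\<lambda>\<omega>. F i \<omega> 0 0)"
    and Ct: "AE \<omega> in M. (SUP i\<in>{..<n}. \<bar>F i \<omega> 0 0\<bar>) \<le> Ct"
    and hyps: "scheme_coefficients M Fl lam Lam n t H" "scheme_solution M Fl n t H F \<xi> Y Z"
      "in_Linf M (Fl T) \<xi>" "driver_measurable Fl n t F" "driver_lipschitz M Ky Kz n F"
      "max_step t n * Ky < 1 - \<epsilon>"
      "AE \<omega> in M. (SUP i\<in>{..<n}. step t i * norm (H i \<omega>)) * Kz < 1"
    using 1 by - (elim conjE, assumption)+
  have n: "0 < n"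
    using grid by (simp add: time_grid_def)
  have F0_le: "Linf_norm M (\<lambda>\<omega>. F j \<omega> 0 0) \<le> ?K" if "j < n" for j
    using that by (intro cSUP_upper) auto
  \<comment> \<open>A real supremum over the empty set would carry no information;
    \<open>0 < n\<close> provides an index.\<close>
  have K: "0 \<le> ?K"
    using F0_le[OF n] Linf_norm_nonneg order_trans by blast
  have "\<forall>j<n. AE \<omega> in M. \<bar>F j \<omega> 0 0\<bar> \<le> ?K"
  proof (intro allI impI)
    fix j assume j: "j < n"
    have "AE \<omega> in M. \<bar>F j \<omega> 0 0\<bar> \<le> Linf_norm M (\<lambda>\<omega>. F j \<omega> 0 0)"
      using F0 j by (intro AE_abs_le_Linf_norm) blast
    then show "AE \<omega> in M. \<bar>F j \<omega> 0 0\<bar> \<le> ?K"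
      by eventually_elim (use F0_le[OF j] in linarith)
  qed
  note bound = scheme_solution_bound[OF \<open>brownian_motion M T W\<close> pos grid
    hyps(1,2)[unfolded Fl_def] AE_abs_le_Linf_norm[OF hyps(3)] hyps(4)[unfolded Fl_def]
    hyps(5-7) this K]
  have Y_le: "AE \<omega> in M. \<bar>Y i \<omega>\<bar> \<le> (?N + T * ?K) * exp (T * Ky / \<epsilon>)" if i: "i \<le> n" for i
    using bound[OF i]
  proof eventually_elim
    case (elim \<omega>)
    \<comment> \<open>Remaining time is enlarged to \<open>T\<close>; the nonnegativity of
      \<open>?N\<close> and \<open>?K\<close> lets both factors grow together.\<close>
    have "(T - t i) * ?K \<le> T * ?K" "(T - t i) * Ky / \<epsilon> \<le> T * Ky / \<epsilon>"
      using time_grid_bounds[OF grid i] K pos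
      by (auto intro!: mult_right_mono divide_right_mono)
    then have "(?N + (T - t i) * ?K) * exp ((T - t i) * Ky / \<epsilon>)
        \<le> (?N + T * ?K) * exp (T * Ky / \<epsilon>)"
      using Linf_norm_nonneg[of \<xi>] K \<open>0 < T\<close> by (intro mult_mono) auto
    with elim show ?case
      by linarith
  qed
  \<comment> \<open>\<open>Ct\<close> bounds a pointwise supremum almost everywhere, whereas
    \<open>?K\<close> is a supremum of norms; the two are compared one index at a time.\<close>
  have "Linf_norm M (\<lambda>\<omega>. F j \<omega> 0 0) \<le> Ct" if "j < n" for j
  proof (rule Linf_norm_le)
    have "subalgebra M (Fl (t j))"
      using subalgebra_brownian_filtration[OF \<open>brownian_motion M T W\<close>]
        time_grid_bounds[OF grid] that by (simp add: Fl_def)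
    then show "(\<lambda>\<omega>. F j \<omega> 0 0) \<in> borel_measurable M"
      using F0 that by (auto simp: in_Linf_def intro: measurable_from_subalg)
    show "AE \<omega> in M. \<bar>F j \<omega> 0 0\<bar> \<le> Ct"
      using Ct
    proof eventually_elim
      case (elim \<omega>)
      have "\<bar>F j \<omega> 0 0\<bar> \<le> (SUP i\<in>{..<n}. \<bar>F i \<omega> 0 0\<bar>)"
        using that by (intro cSUP_upper) auto
      with elim show ?case
        by simp
    qed
  qed
  then have "?K \<le> Ct"
    using n by (intro cSUP_least) auto
  then have "(?N + T * ?K) * exp (T * Ky / \<epsilon>) \<le> (?N + T * Ct) * exp (T * Ky / \<epsilon>)"
    using \<open>0 < T\<close> by (intro mult_right_mono) auto
  with Y_le show ?case
    by blast
qed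

end
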